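(* Let $p$ be an odd prime, $k\ge 2$, $m\ge 1$ and $n=2m$, and let $f:\mathbb{Z}_p^{2m}\to\mathbb{Z}_{p^k}$ be given by $f(\mathbf{x})=\sum_{i=0}^{k-1}f_i(\mathbf{x})p^{k-1-i}$. Let $f_0(\mathbf{x})=\sum_{i=1}^m\beta_ix_ix_{i+m}$, where $\beta_i\in\mathbb{Z}_p$ for $1\le i\le m$, and let $f_i\in\mathcal{A}(x_1,x_2,\dots,x_m;\mathbb{Z}_p)$ for $1\le i\le k-1$. Then $f$ is gbent.
   Context: For a positive integer $r$, $\mathbb{Z}_r$ is the ring of integers modulo $r$ and $\zeta_r=e^{2\pi\sqrt{-1}/r}$. $\mathcal{A}(x_1,\dots,x_m;\mathbb{Z}_p)$ denotes the set of all affine functions $\mathbb{Z}_p^n\to\mathbb{Z}_p$ with variables $x_1,\dots,x_m$ and coefficients in $\mathbb{Z}_p$, i.e. $\mathbf{x}\mapsto c_0+c_1x_1+\cdots+c_mx_m$ with $c_0,\dots,c_m\in\mathbb{Z}_p$. For $f:\mathbb{Z}_p^n\to\mathbb{Z}_{p^k}$, the generalized Walsh-Hadamard transform is $\mathcal{H}_f(\mathbf{u})=p^{-n/2}\sum_{\mathbf{x}\in\mathbb{Z}_p^n}\zeta_p^{-\mathbf{u}\cdot\mathbf{x}}\zeta_{p^k}^{f(\mathbf{x})}$, where $\mathbf{u}\cdot\mathbf{x}=\sum_i u_ix_i \bmod p$; $f$ is gbent if $|\mathcal{H}_f(\mathbf{u})|=1$ for all $\mathbf{u}\in\mathbb{Z}_p^n$.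 In the formula for $f$, the values $f_i(\mathbf{x})\in\mathbb{Z}_p$ are identified with their representatives in $\{0,1,\dots,p-1\}$.
   Formalization: The formal theorem additionally assumes every β_i is non-zero; if some β_j = 0, then f does not depend on x_{j+m}, so H_f(u) = 0 whenever u_{j+m} ≠ 0 and f is not gbent (e.g. p=3, k=2, m=1, f=0). *)

theory Defs
  imports Complex_Main "HOL-Library.FuncSet" "HOL-Computational_Algebra.Primes"
begin

text \<open>The ring of integers modulo \<open>r\<close> is represented by its least non-negative residues;
  ring operations are integer operations followed by reduction modulo \<open>r\<close>.\<close>

definition Zmod :: "nat \<Rightarrow> int set" where
  "Zmod r = {0..<int r}"

text \<open>Coordinates are indexed by \<open>1, \<dots>, n\<close>; extensionality makes each vector
  of \<open>Zvec r n\<close> occur exactly once, so that sums over this set are sums over the module.\<close>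

definition Zvec :: "nat \<Rightarrow> nat \<Rightarrow> (nat \<Rightarrow> int) set" where
  "Zvec r n = {1..n} \<rightarrow>\<^sub>E Zmod r"

definition zeta :: "nat \<Rightarrow> complex" where
  "zeta r = exp (2 * of_real pi * \<i> / of_nat r)"

definition zdot :: "nat \<Rightarrow> nat \<Rightarrow> (nat \<Rightarrow> int) \<Rightarrow> (nat \<Rightarrow> int) \<Rightarrow> int" where
  "zdot p n u x = (\<Sum>i=1..n. u i * x i) mod int p"

text \<open>Affine functions on \<open>Zvec p n\<close> depending only on the first \<open>m\<close> coordinates. Values
  outside \<open>Zvec p n\<close> are irrelevant and left unconstrained.\<close>

definition affine_funs :: "nat \<Rightarrow> nat \<Rightarrow> nat \<Rightarrow> ((nat \<Rightarrow> int) \<Rightarrow> int) set" where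
  "affine_funs p n m =
     {g. \<exists>c \<in> {0..m} \<rightarrow> Zmod p. \<forall>x \<in> Zvec p n. g x = (c 0 + (\<Sum>j=1..m. c j * x j)) mod int p}"

definition gWHT :: "nat \<Rightarrow> nat \<Rightarrow> nat \<Rightarrow> ((nat \<Rightarrow> int) \<Rightarrow> int) \<Rightarrow> (nat \<Rightarrow> int) \<Rightarrow> complex" where
  "gWHT p k n f u =
     of_real (real p powr (- real n / 2)) *
     (\<Sum>x \<in> Zvec p n. zeta p powi (- zdot p n u x) * zeta (p ^ k) powi f x)"

definition gbent :: "nat \<Rightarrow> nat \<Rightarrow> nat \<Rightarrow> ((nat \<Rightarrow> int) \<Rightarrow> int) \<Rightarrow> bool" where
  "gbent p k n f \<longleftrightarrow> (\<forall>u \<in> Zvec p n. cmod (gWHT p k n f u) = 1)"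

end

theory Submission
  imports Defs "HOL-Analysis.Complex_Transcendental" "HOL-Number_Theory.Cong"
begin

text \<open>
  This is the Maiorana-McFarland construction. The leading digit \<open>f\<^sub>0\<close> enters \<open>f\<close> with the
  weight \<open>p\<^bsup>k-1\<^esup>\<close>, so it contributes a \<open>p\<close>-th root of unity; the other digits contribute a
  complex number of modulus 1. Write a vector of length \<open>2 m\<close> as a pair \<open>(y, z)\<close> of halves. The
  lower digits are functions of \<open>y\<close> alone, while \<open>f\<^sub>0\<close> is linear in \<open>z\<close> for each fixed \<open>y\<close>.
  Hence every summand of the Walsh-Hadamard sum at \<open>u\<close> has the form \<open>G y\<close> with \<open>|G y| = 1\<close>,
  times the additive character of \<open>z\<close> whose coefficients are \<open>\<beta>\<^sub>i y\<^sub>i - u\<^bsub>i+m\<^esub>\<close>.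

  Summing over \<open>z\<close> first gives, by orthogonality of characters (\<open>sum_zeta_powi_linear\<close>),
  \<open>p\<^sup>m\<close> when all these coefficients vanish modulo \<open>p\<close> and 0 otherwise. Since every
  \<open>\<beta>\<^sub>i\<close> is a unit modulo the prime \<open>p\<close>, they vanish for exactly one \<open>y\<close>
  (\<open>ex1_Zvec_solution\<close>). A single term of modulus \<open>p\<^sup>m\<close> survives, and the normalising factor
  \<open>p\<^bsup>-m\<^esup>\<close> of the transform brings its modulus to 1 (\<open>norm_sum_bilinear_phase\<close>).
\<close>

section \<open>Additive characters of the residue ring\<close>

lemma zeta_nonzero [simp]: "zeta r \<noteq> 0"
  by (simp add: zeta_def)

lemma norm_zeta_powi [simp]: "cmod (zeta r powi a) = 1"
  by (simp add: zeta_def norm_power_int)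

lemma zeta_powi_exp: "zeta r powi a = exp (of_int a * (2 * of_real pi * \<i> / of_nat r))"
  by (simp add: zeta_def exp_power_int)

lemma zeta_powi_eq_1_iff:
  assumes "r > 0"
  shows "zeta r powi a = 1 \<longleftrightarrow> int r dvd a"
proof -
  have "zeta r powi a = 1 \<longleftrightarrow> (\<exists>n::int. real_of_int a * (2 * pi) / real r = of_int (2 * n) * pi)"
    by (simp add: zeta_powi_exp exp_eq_1)
  also have "\<dots> \<longleftrightarrow> (\<exists>n::int. real_of_int a = real_of_int (int r * n))"
    using assms by (intro ex_cong1) (auto simp: field_simps)
  also have "\<dots> \<longleftrightarrow> int r dvd a"
    by (metis dvd_def of_int_eq_iff)
  finally show ?thesis .
qed

lemma zeta_powi_add: "zeta r powi (a + b) = zeta r powi a * zeta r powi b"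
  by (simp add: power_int_add)

lemma zeta_powi_sum:
  "zeta r powi (\<Sum>i\<in>I. a i) = (\<Prod>i\<in>I. zeta r powi a i)"
  by (induction I rule: infinite_finite_induct) (auto simp: zeta_powi_add)

lemma zeta_powi_cong:
  assumes "r > 0" and "[a = b] (mod int r)"
  shows "zeta r powi a = zeta r powi b"
proof -
  have "zeta r powi (a - b) = 1"
    using assms by (simp add: zeta_powi_eq_1_iff cong_iff_dvd_diff)
  then show ?thesis
    using zeta_powi_add[of r "a - b" b] by simp
qed

text \<open>The most significant base-\<open>p\<close> digit of an exponent modulo \<open>p\<^sup>k\<close> is seen by \<open>\<zeta>\<^sub>p\<close>, because
  \<open>\<zeta>\<close> of order \<open>p\<^sup>k\<close> raised to \<open>p\<^bsup>k-1\<^esup>\<close> is \<open>\<zeta>\<^sub>p\<close>.\<close>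

lemma zeta_power_powi_mult:
  assumes "p > 0" and "k \<ge> 1"
  shows "zeta (p ^ k) powi (a * int p ^ (k - 1)) = zeta p powi a"
proof -
  have "p ^ k = p * p ^ (k - 1)"
    using assms by (simp add: power_eq_if)
  then show ?thesis
    using assms by (simp add: zeta_powi_exp field_simps)
qed

text \<open>Over the residues \<open>t\<close>, the summands are the powers of one \<open>r\<close>-th root of unity. It equals 1
  exactly when \<open>r\<close> divides \<open>a\<close>; otherwise the geometric sum runs over a full period and
  cancels.\<close>

lemma sum_zeta_powi_mult:
  assumes "r > 0"
  shows "(\<Sum>t\<in>Zmod r. zeta r powi (a * t)) = (if int r dvd a then of_nat r else 0)"
proof -
  define w where "w = zeta r powi a"
  have "(\<Sum>t\<in>Zmod r. zeta r powi (a * t)) = (\<Sum>t<r. w ^ t)"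
    unfolding Zmod_def w_def
    by (rule sum.reindex_bij_witness[of _ int nat]) (auto simp: power_int_mult simp flip: power_int_of_nat)
  also have "\<dots> = (if int r dvd a then of_nat r else 0)"
  proof (cases "int r dvd a")
    case True
    then have "w = 1"
      using assms by (simp add: w_def zeta_powi_eq_1_iff)
    then show ?thesis using True by simp
  next
    case False
    then have "w \<noteq> 1"
      using assms by (simp add: w_def zeta_powi_eq_1_iff)
    moreover have "w ^ r = 1"
      using zeta_powi_eq_1_iff[OF assms, of "a * int r"]
      by (simp add: w_def power_int_mult)
    ultimately show ?thesis using False by (simp add: sum_gp_strict)
  qed
  finally show ?thesis .
qed

section \<open>Vectors over the residue ring\<close>

lemma finite_Zvec [simp]: "finite (Zvec r n)"
  by (simp add: Zvec_def Zmod_def finite_PiE)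

text \<open>Orthogonality in several variables: the character of a linear form is a product of
  characters in one coordinate each, so the sum factors, and one coefficient that is nonzero
  modulo \<open>r\<close> is enough to annihilate it.\<close>

lemma sum_zeta_powi_linear:
  assumes "r > 0"
  shows "(\<Sum>z\<in>Zvec r m. zeta r powi (\<Sum>i=1..m. a i * z i)) =
         (if \<forall>i\<in>{1..m}. int r dvd a i then of_nat r ^ m else 0)"
proof -
  have "(\<Sum>z\<in>Zvec r m. zeta r powi (\<Sum>i=1..m. a i * z i)) =
        (\<Sum>z\<in>Zvec r m. \<Prod>i=1..m. zeta r powi (a i * z i))"
    by (simp add: zeta_powi_sum)
  also have "\<dots> = (\<Prod>i=1..m. \<Sum>t\<in>Zmod r. zeta r powi (a i * t))"
    unfolding Zvec_def by (rule prod_sum_PiE[symmetric]) (auto simp: Zmod_def)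
  also have "\<dots> = (\<Prod>i=1..m. if int r dvd a i then of_nat r else 0)"
    using assms by (simp add: sum_zeta_powi_mult)
  also have "\<dots> = (if \<forall>i\<in>{1..m}. int r dvd a i then of_nat r ^ m else 0)"
    by (auto intro!: prod_zero)
  finally show ?thesis .
qed

text \<open>No case for indices beyond \<open>2 m\<close> is necessary when \<open>z\<close> is a vector of length \<open>m\<close>: such an
  index is shifted outside the domain of \<open>z\<close>, where \<open>z\<close> is already \<open>undefined\<close>.\<close>

definition join :: "nat \<Rightarrow> (nat \<Rightarrow> int) \<Rightarrow> (nat \<Rightarrow> int) \<Rightarrow> nat \<Rightarrow> int" where
  "join m y z i = (if i \<le> m then y i else z (i - m))"

lemma join_in_Zvec:
  assumes "y \<in> Zvec r m" and "z \<in> Zvec r m"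
  shows "join m y z \<in> Zvec r (2 * m)"
  unfolding Zvec_def
proof (rule PiE_I)
  fix i assume i: "i \<in> {1..2 * m}"
  show "join m y z i \<in> Zmod r"
  proof (cases "i \<le> m")
    case True
    then show ?thesis using assms(1) i by (auto simp: Zvec_def join_def)
  next
    case False
    then have "i - m \<in> {1..m}" using i by auto
    then show ?thesis using assms(2) False by (auto simp: Zvec_def join_def)
  qed
next
  fix i assume i: "i \<notin> {1..2 * m}"
  show "join m y z i = undefined"
  proof (cases "i \<le> m")
    case True
    then have "i \<notin> {1..m}" using i by auto
    then show ?thesis using assms(1) True by (auto simp: Zvec_def join_def)
  next
    case False
    then have "i - m \<notin> {1..m}" using i by auto
    then show ?thesis using assms(2) False by (auto simp: Zvec_def join_def)
  qed
qed

lemma sum_Zvec_double: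
  "(\<Sum>x\<in>Zvec r (2 * m). g x) = (\<Sum>y\<in>Zvec r m. \<Sum>z\<in>Zvec r m. g (join m y z))"
proof -
  have "(\<Sum>x\<in>Zvec r (2 * m). g x) =
        (\<Sum>(y, z)\<in>Zvec r m \<times> Zvec r m. g (join m y z))"
  proof (rule sum.reindex_bij_witness[of _ "\<lambda>(y, z). join m y z"
        "\<lambda>x. (restrict x {1..m}, restrict (\<lambda>i. x (i + m)) {1..m})"])
    fix x assume x: "x \<in> Zvec r (2 * m)"
    show *: "(case (restrict x {1..m}, restrict (\<lambda>i. x (i + m)) {1..m}) of (y, z) \<Rightarrow> join m y z) = x"
      using x by (auto simp: join_def fun_eq_iff Zvec_def PiE_iff extensional_def)
    show "(restrict x {1..m}, restrict (\<lambda>i. x (i + m)) {1..m}) \<in> Zvec r m \<times> Zvec r m"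
      using x by (auto simp: Zvec_def PiE_iff)
    show "(case (restrict x {1..m}, restrict (\<lambda>i. x (i + m)) {1..m}) of (y, z) \<Rightarrow> g (join m y z)) = g x"
      using * by simp
  next
    fix yz assume "yz \<in> Zvec r m \<times> Zvec r m"
    then obtain y z where yz: "yz = (y, z)" "y \<in> Zvec r m" "z \<in> Zvec r m" by blast
    then show "(case yz of (y, z) \<Rightarrow> join m y z) \<in> Zvec r (2 * m)"
      by (simp add: join_in_Zvec)
    show "(restrict (case yz of (y, z) \<Rightarrow> join m y z) {1..m},
           restrict (\<lambda>i. (case yz of (y, z) \<Rightarrow> join m y z) (i + m)) {1..m}) = yz"
      using yz by (auto simp: join_def fun_eq_iff Zvec_def PiE_iff extensional_def)
  qed
  then show ?thesis by (simp add: sum.cartesian_product)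
qed

lemma sum_lower_upper:
  fixes h :: "nat \<Rightarrow> int"
  shows "(\<Sum>i=1..2 * m. h i) = (\<Sum>i=1..m. h i) + (\<Sum>i=1..m. h (i + m))"
proof -
  have "(\<Sum>i=1..2 * m. h i) = (\<Sum>i=1..m. h i) + (\<Sum>i=m+1..m + m. h i)"
    using sum.ub_add_nat[of 1 m h m] by (simp add: mult_2)
  also have "(\<Sum>i=m+1..m + m. h i) = (\<Sum>i=1..m. h (i + m))"
    using sum.shift_bounds_cl_nat_ivl[of h 1 m m] by (simp add: add.commute)
  finally show ?thesis .
qed

section \<open>The Maiorana-McFarland construction\<close>

lemma ex1_residue_solution:
  assumes "prime p" and "b \<in> Zmod p" and "b \<noteq> 0"
  shows "\<exists>!t. t \<in> Zmod p \<and> int p dvd b * t - v"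
proof -
  have p0: "int p > 0" using assms(1) by (simp add: prime_gt_0_nat)
  have ndvd: "\<not> int p dvd b"
    using assms(2,3) by (auto simp: Zmod_def dest: zdvd_imp_le)
  have pr: "prime (int p)" using assms(1) by simp
  have "coprime b (int p)"
    using prime_imp_coprime[OF pr ndvd] by (simp add: coprime_commute)
  then obtain c where c: "[b * c = 1] (mod int p)"
    using cong_solve_coprime_int by blast
  show ?thesis
  proof (rule ex1I[of _ "(c * v) mod int p"])
    have "[b * ((c * v) mod int p) = b * (c * v)] (mod int p)"
      by (simp add: cong_def mod_mult_right_eq)
    also have "b * (c * v) = (b * c) * v" by simp
    also have "[(b * c) * v = 1 * v] (mod int p)"
      using c by (rule cong_scalar_right)
    finally show "(c * v) mod int p \<in> Zmod p \<and> int p dvd b * ((c * v) mod int p) - v"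
      using p0 by (simp add: Zmod_def cong_iff_dvd_diff)
  next
    fix t assume t: "t \<in> Zmod p \<and> int p dvd b * t - v"
    have "[b * t = v] (mod int p)" using t by (simp add: cong_iff_dvd_diff)
    then have "[c * (b * t) = c * v] (mod int p)" by (rule cong_scalar_left)
    moreover have "[(b * c) * t = 1 * t] (mod int p)"
      using c by (rule cong_scalar_right)
    ultimately have "[t = c * v] (mod int p)"
      by (metis cong_sym cong_trans mult.assoc mult.commute mult_1)
    then show "t = (c * v) mod int p"
      using t by (simp add: cong_def Zmod_def)
  qed
qed

text \<open>The coordinatewise map \<open>y \<mapsto> (b\<^sub>i y\<^sub>i)\<^sub>i\<close> permutes the vectors modulo \<open>p\<close>, because nonzero residues
  modulo a prime are units. This expresses that the quadratic form
  \<open>\<Sum>\<^sub>i b\<^sub>i y\<^sub>i z\<^sub>i\<close> is nondegenerate.\<close>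

lemma ex1_Zvec_solution:
  assumes "prime p" and "\<And>i. i \<in> {1..m} \<Longrightarrow> b i \<in> Zmod p \<and> b i \<noteq> 0"
  shows "\<exists>!y. y \<in> Zvec p m \<and> (\<forall>i\<in>{1..m}. int p dvd b i * y i - v i)"
proof -
  have "\<exists>!t. t \<in> Zmod p \<and> int p dvd b i * t - v i" if "i \<in> {1..m}" for i
    using ex1_residue_solution assms that by blast
  then obtain s where s: "\<And>i. i \<in> {1..m} \<Longrightarrow> s i \<in> Zmod p \<and> int p dvd b i * s i - v i"
    and uniq: "\<And>i t. i \<in> {1..m} \<Longrightarrow> t \<in> Zmod p \<Longrightarrow> int p dvd b i * t - v i \<Longrightarrow> t = s i"
    by metis
  show ?thesis
  proof (rule ex1I[of _ "restrict s {1..m}"])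
    show "restrict s {1..m} \<in> Zvec p m \<and> (\<forall>i\<in>{1..m}. int p dvd b i * restrict s {1..m} i - v i)"
      using s by (auto simp: Zvec_def)
  next
    fix y assume "y \<in> Zvec p m \<and> (\<forall>i\<in>{1..m}. int p dvd b i * y i - v i)"
    then show "y = restrict s {1..m}"
      using uniq by (auto simp: Zvec_def PiE_iff extensional_def fun_eq_iff)
  qed
qed

text \<open>The core of the construction. The factor \<open>G\<close> is an arbitrary phase because only its value
  at the one surviving \<open>y\<close> matters.\<close>

lemma norm_sum_bilinear_phase:
  assumes "prime p" and "\<And>i. i \<in> {1..m} \<Longrightarrow> b i \<in> Zmod p \<and> b i \<noteq> 0"
    and "\<And>y. y \<in> Zvec p m \<Longrightarrow> cmod (G y) = 1"
  shows "cmod (\<Sum>y\<in>Zvec p m. \<Sum>z\<in>Zvec p m.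
           G y * zeta p powi (\<Sum>i=1..m. (b i * y i - v i) * z i)) = real p ^ m"
proof -
  have p0: "p > 0" using assms(1) by (simp add: prime_gt_0_nat)
  have ex1: "\<exists>!y. y \<in> Zvec p m \<and> (\<forall>i\<in>{1..m}. int p dvd b i * y i - v i)"
    using assms(1,2) by (rule ex1_Zvec_solution)
  then obtain s where s: "s \<in> Zvec p m" "\<forall>i\<in>{1..m}. int p dvd b i * s i - v i"
    by blast
  have s_iff: "(\<forall>i\<in>{1..m}. int p dvd b i * y i - v i) \<longleftrightarrow> y = s" if "y \<in> Zvec p m" for y
    using ex1 s that by blast
  have "(\<Sum>y\<in>Zvec p m. \<Sum>z\<in>Zvec p m. G y * zeta p powi (\<Sum>i=1..m. (b i * y i - v i) * z i)) =
        (\<Sum>y\<in>Zvec p m. G y * (if \<forall>i\<in>{1..m}. int p dvd b i * y i - v i then of_nat p ^ m else 0))"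
    by (simp only: sum_distrib_left[symmetric] sum_zeta_powi_linear[OF p0])
  also have "\<dots> = (\<Sum>y\<in>Zvec p m. if y = s then G s * of_nat p ^ m else 0)"
    by (rule sum.cong) (simp_all only: s_iff, auto)
  also have "\<dots> = G s * of_nat p ^ m"
    using s(1) by (simp add: sum.delta)
  finally show ?thesis
    using assms(3)[OF s(1)] by (simp add: norm_mult norm_power)
qed

lemma affine_funs_join:
  assumes "g \<in> affine_funs p (2 * m) m"
  shows "\<exists>h. \<forall>y\<in>Zvec p m. \<forall>z\<in>Zvec p m. g (join m y z) = h y"
proof -
  obtain c where c: "\<And>x. x \<in> Zvec p (2 * m) \<Longrightarrow>
      g x = (c 0 + (\<Sum>j=1..m. c j * x j)) mod int p"
    using assms by (auto simp: affine_funs_def)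
  have "g (join m y z) = (c 0 + (\<Sum>j=1..m. c j * y j)) mod int p"
    if "y \<in> Zvec p m" "z \<in> Zvec p m" for y z
    using c[OF join_in_Zvec[OF that]] by (simp add: join_def)
  then show ?thesis
    by (intro exI[of _ "\<lambda>y. (c 0 + (\<Sum>j=1..m. c j * y j)) mod int p"]) simp
qed

theorem theorem4p1:
  fixes p k m n :: nat
    and f :: "(nat \<Rightarrow> int) \<Rightarrow> int"
    and F :: "nat \<Rightarrow> (nat \<Rightarrow> int) \<Rightarrow> int"
    and \<beta> :: "nat \<Rightarrow> int"
  assumes "prime p" and "odd p" and "k \<ge> 2" and "m \<ge> 1" and "n = 2 * m"
    and "f \<in> Zvec p n \<rightarrow> Zmod (p ^ k)"
    and "\<And>x. x \<in> Zvec p n \<Longrightarrow>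
           f x = (\<Sum>i=0..k-1. F i x * int p ^ (k - 1 - i)) mod int (p ^ k)"
    and "\<And>i. i \<in> {1..m} \<Longrightarrow> \<beta> i \<in> Zmod p"
    and "\<And>i. i \<in> {1..m} \<Longrightarrow> \<beta> i \<noteq> 0"
    and "\<And>x. x \<in> Zvec p n \<Longrightarrow> F 0 x = (\<Sum>i=1..m. \<beta> i * x i * x (i + m)) mod int p"
    and "\<And>i. i \<in> {1..k-1} \<Longrightarrow> F i \<in> affine_funs p n m"
  shows "gbent p k n f"
  unfolding gbent_def
proof
  fix u assume "u \<in> Zvec p n"
  have p0: "p > 0" using assms(1) by (simp add: prime_gt_0_nat)
  have "\<exists>h. \<forall>y\<in>Zvec p m. \<forall>z\<in>Zvec p m. F i (join m y z) = h y" if "i \<in> {1..k-1}" for i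
    using affine_funs_join[OF assms(11)[OF that, unfolded assms(5)]] .
  then obtain h where h: "\<And>i y z. i \<in> {1..k-1} \<Longrightarrow> y \<in> Zvec p m \<Longrightarrow> z \<in> Zvec p m \<Longrightarrow>
      F i (join m y z) = h i y"
    by metis
  \<comment> \<open>\<open>G\<close> collects everything that depends on \<open>y\<close> alone: the digits of weight below \<open>p\<^bsup>k-1\<^esup>\<close>
    and the first half of the inner product with \<open>u\<close>.\<close>
  define G where "G y = zeta (p ^ k) powi (\<Sum>i=1..k-1. h i y * int p ^ (k - 1 - i)) *
      zeta p powi (- (\<Sum>i=1..m. u i * y i))" for y
  have phase: "zeta p powi (- zdot p n u x) * zeta (p ^ k) powi f x =
      G y * zeta p powi (\<Sum>i=1..m. (\<beta> i * y i - u (i + m)) * z i)"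
    if yz: "y \<in> Zvec p m" "z \<in> Zvec p m" and x: "x = join m y z" for x y z
  proof -
    have xn: "x \<in> Zvec p n" using join_in_Zvec[OF yz] assms(5) x by simp
    have lower: "x i = y i" and upper: "x (i + m) = z i" if "i \<in> {1..m}" for i
      using that by (auto simp: x join_def)
    have "zeta p powi (- zdot p n u x) = zeta p powi (- (\<Sum>i=1..n. u i * x i))"
      unfolding zdot_def by (rule zeta_powi_cong[OF p0]) (simp add: cong_def mod_minus_eq)
    also have "(\<Sum>i=1..n. u i * x i) =
        (\<Sum>i=1..m. u i * y i) + (\<Sum>i=1..m. u (i + m) * z i)"
      unfolding assms(5) sum_lower_upper by (simp add: lower upper)
    finally have dot: "zeta p powi (- zdot p n u x) =
        zeta p powi (- (\<Sum>i=1..m. u i * y i)) * zeta p powi (- (\<Sum>i=1..m. u (i + m) * z i))"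
      by (simp flip: zeta_powi_add)
    have "zeta (p ^ k) powi f x =
        zeta (p ^ k) powi (\<Sum>i=0..k-1. F i x * int p ^ (k - 1 - i))"
      unfolding assms(7)[OF xn] by (rule zeta_powi_cong) (use p0 in \<open>simp_all add: cong_def\<close>)
    also have "(\<Sum>i=0..k-1. F i x * int p ^ (k - 1 - i)) =
        F 0 x * int p ^ (k - 1) + (\<Sum>i=1..k-1. h i y * int p ^ (k - 1 - i))"
      using h yz by (simp add: sum.atLeast_Suc_atMost x)
    also have "zeta (p ^ k) powi \<dots> = zeta p powi F 0 x *
        zeta (p ^ k) powi (\<Sum>i=1..k-1. h i y * int p ^ (k - 1 - i))"
      using p0 assms(3) by (simp only: zeta_powi_add zeta_power_powi_mult)
    also have "zeta p powi F 0 x = zeta p powi (\<Sum>i=1..m. \<beta> i * x i * x (i + m))"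
      unfolding assms(10)[OF xn] by (rule zeta_powi_cong[OF p0]) (simp add: cong_def)
    also have "(\<Sum>i=1..m. \<beta> i * x i * x (i + m)) = (\<Sum>i=1..m. \<beta> i * y i * z i)"
      by (simp add: lower upper)
    finally have val: "zeta (p ^ k) powi f x = zeta p powi (\<Sum>i=1..m. \<beta> i * y i * z i) *
        zeta (p ^ k) powi (\<Sum>i=1..k-1. h i y * int p ^ (k - 1 - i))" .
    have "zeta p powi (\<Sum>i=1..m. (\<beta> i * y i - u (i + m)) * z i) =
        zeta p powi (\<Sum>i=1..m. \<beta> i * y i * z i) * zeta p powi (- (\<Sum>i=1..m. u (i + m) * z i))"
      by (simp add: left_diff_distrib sum_subtractf flip: zeta_powi_add)
    then show ?thesis
      by (simp add: dot val G_def)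
  qed
  have "cmod (\<Sum>x\<in>Zvec p n. zeta p powi (- zdot p n u x) * zeta (p ^ k) powi f x) =
      cmod (\<Sum>y\<in>Zvec p m. \<Sum>z\<in>Zvec p m.
        G y * zeta p powi (\<Sum>i=1..m. (\<beta> i * y i - u (i + m)) * z i))"
    using phase by (simp add: assms(5) sum_Zvec_double)
  also have "\<dots> = real p ^ m"
    by (rule norm_sum_bilinear_phase) (use assms in \<open>auto simp: G_def norm_mult\<close>)
  finally show "cmod (gWHT p k n f u) = 1"
    using p0 by (simp add: gWHT_def norm_mult norm_inverse norm_power assms(5) powr_minus powr_realpow)
qed

end
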